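(* Let $\delta\in\mathbb{K}$. The category $\mathcal{C}=\mathcal{C}^{0,0}_{1,1}(+,1,1)$, where $\varsigma$ and $\lambda$ are scaled to one, is isomorphic (as a strict monoidal category) to the Brauer category $\mathcal{B}(+1)$ with loop parameter $\delta$.
   Context: $\mathbb{K}$ is a field of characteristic different from 2; everything is $\mathbb{K}$-linear. Both categories are strict monoidal categories with one generating object $\bullet$; $m$ denotes $\bullet^{\otimes m}$, $I$ the identity of $\bullet$, $1_2$ the identity of $\bullet^{\otimes 2}$; both are generated by $H\in\mathrm{Hom}(2,2)$ (cross), $A\in\mathrm{Hom}(2,0)$ (cap), $U\in\mathrm{Hom}(0,2)$ (cup). The relations of $\mathcal{C}$ are: $HU=U$, $AH=A$; $AU=\delta$; $(A\otimes I)(I\otimes U)=I=(I\otimes A)(U\otimes I)$; $(A\otimes I)(I\otimes H)(U\otimes I)=I$; $H^2=1_2$; $(H\otimes I)(I\otimes U)=(I\otimes H)(U\otimes I)$; $(H\otimes I)(I\otimes H)(U\otimes I)=I\otimes U$; $(I\otimes A)(H\otimes I)=(A\otimes I)(I\otimes H)$; $(A\otimes I)(I\otimes H)(H\otimes I)=I\otimes A$; $(H\otimes I)(I\otimes H)(H\otimes I)=(I\otimes H)(H\otimes I)(I\otimes H)$. (These are the defining relations of the category of Brauer type with $\lambda=\lambda'=\varsigma=\varsigma'=a=\rho=e=e'=F=F'=1$ and $b=c=d=d'=f=f'=D=E=D'=E'=0$.) The Brauer category $\mathcal{B}(+1)$ is presented by the relations: $H^2=1_2$; $(H\otimes I)(I\otimes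 H)(H\otimes I)=(I\otimes H)(H\otimes I)(I\otimes H)$; $(A\otimes I)(I\otimes U)=I$; $(I\otimes A)(U\otimes I)=I$; $(I\otimes H)(U\otimes I)=(H\otimes I)(I\otimes U)$; $HU=U$; $AU=\delta$. *)

theory Defs
  imports Main
begin

section \<open>Strict monoidal linear categories\<close>

text \<open>
  \<open>'o\<close> is the type of objects, \<open>'m\<close> the type of morphisms and \<open>'k\<close> the ground field.
  Composition is written in the usual order: \<open>Cmp C g f\<close> is \<open>g\<close> after \<open>f\<close>.
\<close>

record ('o, 'm, 'k) lin_mon_cat =
  Obj   :: "'o set"
  Hom   :: "'o \<Rightarrow> 'o \<Rightarrow> 'm set"
  Ide   :: "'o \<Rightarrow> 'm"
  Cmp   :: "'m \<Rightarrow> 'm \<Rightarrow> 'm"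
  Add   :: "'m \<Rightarrow> 'm \<Rightarrow> 'm"
  Zer   :: "'o \<Rightarrow> 'o \<Rightarrow> 'm"
  Scl   :: "'k \<Rightarrow> 'm \<Rightarrow> 'm"
  Unt   :: "'o"
  OTen  :: "'o \<Rightarrow> 'o \<Rightarrow> 'o"
  MTen  :: "'m \<Rightarrow> 'm \<Rightarrow> 'm"

locale lin_category =
  fixes C :: "('o, 'm, 'k::field) lin_mon_cat"
  assumes hom_disjoint:
      "\<lbrakk>X \<in> Obj C; Y \<in> Obj C; X' \<in> Obj C; Y' \<in> Obj C; f \<in> Hom C X Y; f \<in> Hom C X' Y'\<rbrakk>
        \<Longrightarrow> X = X' \<and> Y = Y'"
    and ide_hom: "X \<in> Obj C \<Longrightarrow> Ide C X \<in> Hom C X X"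
    and cmp_hom:
      "\<lbrakk>X \<in> Obj C; Y \<in> Obj C; Z \<in> Obj C; f \<in> Hom C X Y; g \<in> Hom C Y Z\<rbrakk>
        \<Longrightarrow> Cmp C g f \<in> Hom C X Z"
    and ide_left: "\<lbrakk>X \<in> Obj C; Y \<in> Obj C; f \<in> Hom C X Y\<rbrakk> \<Longrightarrow> Cmp C (Ide C Y) f = f"
    and ide_right: "\<lbrakk>X \<in> Obj C; Y \<in> Obj C; f \<in> Hom C X Y\<rbrakk> \<Longrightarrow> Cmp C f (Ide C X) = f"
    and cmp_assoc:
      "\<lbrakk>W \<in> Obj C; X \<in> Obj C; Y \<in> Obj C; Z \<in> Obj C;
        f \<in> Hom C W X; g \<in> Hom C X Y; h \<in> Hom C Y Z\<rbrakk>
        \<Longrightarrow> Cmp C (Cmp C h g) f = Cmp C h (Cmp C g f)"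
    and add_hom:
      "\<lbrakk>X \<in> Obj C; Y \<in> Obj C; f \<in> Hom C X Y; g \<in> Hom C X Y\<rbrakk> \<Longrightarrow> Add C f g \<in> Hom C X Y"
    and zer_hom: "\<lbrakk>X \<in> Obj C; Y \<in> Obj C\<rbrakk> \<Longrightarrow> Zer C X Y \<in> Hom C X Y"
    and scl_hom: "\<lbrakk>X \<in> Obj C; Y \<in> Obj C; f \<in> Hom C X Y\<rbrakk> \<Longrightarrow> Scl C a f \<in> Hom C X Y"
    and add_assoc:
      "\<lbrakk>X \<in> Obj C; Y \<in> Obj C; f \<in> Hom C X Y; g \<in> Hom C X Y; h \<in> Hom C X Y\<rbrakk>
        \<Longrightarrow> Add C (Add C f g) h = Add C f (Add C g h)"
    and add_commute:
      "\<lbrakk>X \<in> Obj C; Y \<in> Obj C; f \<in> Hom C X Y; g \<in> Hom C X Y\<rbrakk> \<Longrightarrow> Add C f g = Add C g f"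
    and add_zer: "\<lbrakk>X \<in> Obj C; Y \<in> Obj C; f \<in> Hom C X Y\<rbrakk> \<Longrightarrow> Add C f (Zer C X Y) = f"
    and add_inverse:
      "\<lbrakk>X \<in> Obj C; Y \<in> Obj C; f \<in> Hom C X Y\<rbrakk> \<Longrightarrow> \<exists>g\<in>Hom C X Y. Add C f g = Zer C X Y"
    and scl_one: "\<lbrakk>X \<in> Obj C; Y \<in> Obj C; f \<in> Hom C X Y\<rbrakk> \<Longrightarrow> Scl C 1 f = f"
    and scl_scl:
      "\<lbrakk>X \<in> Obj C; Y \<in> Obj C; f \<in> Hom C X Y\<rbrakk> \<Longrightarrow> Scl C a (Scl C b f) = Scl C (a * b) f"
    and scl_add:
      "\<lbrakk>X \<in> Obj C; Y \<in> Obj C; f \<in> Hom C X Y; g \<in> Hom C X Y\<rbrakk>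
        \<Longrightarrow> Scl C a (Add C f g) = Add C (Scl C a f) (Scl C a g)"
    and add_scl:
      "\<lbrakk>X \<in> Obj C; Y \<in> Obj C; f \<in> Hom C X Y\<rbrakk>
        \<Longrightarrow> Scl C (a + b) f = Add C (Scl C a f) (Scl C b f)"
    and cmp_add_left:
      "\<lbrakk>X \<in> Obj C; Y \<in> Obj C; Z \<in> Obj C; f \<in> Hom C X Y; g \<in> Hom C Y Z; h \<in> Hom C Y Z\<rbrakk>
        \<Longrightarrow> Cmp C (Add C g h) f = Add C (Cmp C g f) (Cmp C h f)"
    and cmp_add_right:
      "\<lbrakk>X \<in> Obj C; Y \<in> Obj C; Z \<in> Obj C; f \<in> Hom C X Y; g \<in> Hom C X Y; h \<in> Hom C Y Z\<rbrakk>
        \<Longrightarrow> Cmp C h (Add C f g) = Add C (Cmp C h f) (Cmp C h g)"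
    and cmp_scl_left:
      "\<lbrakk>X \<in> Obj C; Y \<in> Obj C; Z \<in> Obj C; f \<in> Hom C X Y; g \<in> Hom C Y Z\<rbrakk>
        \<Longrightarrow> Cmp C (Scl C a g) f = Scl C a (Cmp C g f)"
    and cmp_scl_right:
      "\<lbrakk>X \<in> Obj C; Y \<in> Obj C; Z \<in> Obj C; f \<in> Hom C X Y; g \<in> Hom C Y Z\<rbrakk>
        \<Longrightarrow> Cmp C g (Scl C a f) = Scl C a (Cmp C g f)"

locale strict_monoidal_lin_category = lin_category +
  assumes unt_obj: "Unt C \<in> Obj C"
    and oten_obj: "\<lbrakk>X \<in> Obj C; Y \<in> Obj C\<rbrakk> \<Longrightarrow> OTen C X Y \<in> Obj C"
    and oten_assoc:
      "\<lbrakk>X \<in> Obj C; Y \<in> Obj C; Z \<in> Obj C\<rbrakk>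
        \<Longrightarrow> OTen C (OTen C X Y) Z = OTen C X (OTen C Y Z)"
    and oten_unt_left: "X \<in> Obj C \<Longrightarrow> OTen C (Unt C) X = X"
    and oten_unt_right: "X \<in> Obj C \<Longrightarrow> OTen C X (Unt C) = X"
    and mten_hom:
      "\<lbrakk>X \<in> Obj C; Y \<in> Obj C; X' \<in> Obj C; Y' \<in> Obj C; f \<in> Hom C X Y; f' \<in> Hom C X' Y'\<rbrakk>
        \<Longrightarrow> MTen C f f' \<in> Hom C (OTen C X X') (OTen C Y Y')"
    and mten_ide:
      "\<lbrakk>X \<in> Obj C; Y \<in> Obj C\<rbrakk> \<Longrightarrow> MTen C (Ide C X) (Ide C Y) = Ide C (OTen C X Y)"
    and interchange:
      "\<lbrakk>X \<in> Obj C; Y \<in> Obj C; Z \<in> Obj C; X' \<in> Obj C; Y' \<in> Obj C; Z' \<in> Obj C;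
        f \<in> Hom C X Y; g \<in> Hom C Y Z; f' \<in> Hom C X' Y'; g' \<in> Hom C Y' Z'\<rbrakk>
        \<Longrightarrow> Cmp C (MTen C g g') (MTen C f f') = MTen C (Cmp C g f) (Cmp C g' f')"
    and mten_assoc:
      "\<lbrakk>X \<in> Obj C; Y \<in> Obj C; X' \<in> Obj C; Y' \<in> Obj C; X'' \<in> Obj C; Y'' \<in> Obj C;
        f \<in> Hom C X Y; f' \<in> Hom C X' Y'; f'' \<in> Hom C X'' Y''\<rbrakk>
        \<Longrightarrow> MTen C (MTen C f f') f'' = MTen C f (MTen C f' f'')"
    and mten_unt_left:
      "\<lbrakk>X \<in> Obj C; Y \<in> Obj C; f \<in> Hom C X Y\<rbrakk> \<Longrightarrow> MTen C (Ide C (Unt C)) f = f"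
    and mten_unt_right:
      "\<lbrakk>X \<in> Obj C; Y \<in> Obj C; f \<in> Hom C X Y\<rbrakk> \<Longrightarrow> MTen C f (Ide C (Unt C)) = f"
    and mten_add_left:
      "\<lbrakk>X \<in> Obj C; Y \<in> Obj C; X' \<in> Obj C; Y' \<in> Obj C;
        f \<in> Hom C X Y; g \<in> Hom C X Y; f' \<in> Hom C X' Y'\<rbrakk>
        \<Longrightarrow> MTen C (Add C f g) f' = Add C (MTen C f f') (MTen C g f')"
    and mten_add_right:
      "\<lbrakk>X \<in> Obj C; Y \<in> Obj C; X' \<in> Obj C; Y' \<in> Obj C;
        f \<in> Hom C X Y; f' \<in> Hom C X' Y'; g' \<in> Hom C X' Y'\<rbrakk>
        \<Longrightarrow> MTen C f (Add C f' g') = Add C (MTen C f f') (MTen C f g')"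
    and mten_scl_left:
      "\<lbrakk>X \<in> Obj C; Y \<in> Obj C; X' \<in> Obj C; Y' \<in> Obj C; f \<in> Hom C X Y; f' \<in> Hom C X' Y'\<rbrakk>
        \<Longrightarrow> MTen C (Scl C a f) f' = Scl C a (MTen C f f')"
    and mten_scl_right:
      "\<lbrakk>X \<in> Obj C; Y \<in> Obj C; X' \<in> Obj C; Y' \<in> Obj C; f \<in> Hom C X Y; f' \<in> Hom C X' Y'\<rbrakk>
        \<Longrightarrow> MTen C f (Scl C a f') = Scl C a (MTen C f f')"

locale strict_monoidal_lin_functor =
  dom: strict_monoidal_lin_category C + cod: strict_monoidal_lin_category D
  for C :: "('o, 'm, 'k::field) lin_mon_cat" and D :: "('p, 'n, 'k) lin_mon_cat" +
  fixes F\<^sub>o :: "'o \<Rightarrow> 'p" and F\<^sub>m :: "'m \<Rightarrow> 'n"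
  assumes F_obj: "X \<in> Obj C \<Longrightarrow> F\<^sub>o X \<in> Obj D"
    and F_hom: "\<lbrakk>X \<in> Obj C; Y \<in> Obj C; f \<in> Hom C X Y\<rbrakk> \<Longrightarrow> F\<^sub>m f \<in> Hom D (F\<^sub>o X) (F\<^sub>o Y)"
    and F_ide: "X \<in> Obj C \<Longrightarrow> F\<^sub>m (Ide C X) = Ide D (F\<^sub>o X)"
    and F_cmp:
      "\<lbrakk>X \<in> Obj C; Y \<in> Obj C; Z \<in> Obj C; f \<in> Hom C X Y; g \<in> Hom C Y Z\<rbrakk>
        \<Longrightarrow> F\<^sub>m (Cmp C g f) = Cmp D (F\<^sub>m g) (F\<^sub>m f)"
    and F_add:
      "\<lbrakk>X \<in> Obj C; Y \<in> Obj C; f \<in> Hom C X Y; g \<in> Hom C X Y\<rbrakk>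
        \<Longrightarrow> F\<^sub>m (Add C f g) = Add D (F\<^sub>m f) (F\<^sub>m g)"
    and F_scl:
      "\<lbrakk>X \<in> Obj C; Y \<in> Obj C; f \<in> Hom C X Y\<rbrakk> \<Longrightarrow> F\<^sub>m (Scl C a f) = Scl D a (F\<^sub>m f)"
    and F_unt: "F\<^sub>o (Unt C) = Unt D"
    and F_oten: "\<lbrakk>X \<in> Obj C; Y \<in> Obj C\<rbrakk> \<Longrightarrow> F\<^sub>o (OTen C X Y) = OTen D (F\<^sub>o X) (F\<^sub>o Y)"
    and F_mten:
      "\<lbrakk>X \<in> Obj C; Y \<in> Obj C; X' \<in> Obj C; Y' \<in> Obj C; f \<in> Hom C X Y; f' \<in> Hom C X' Y'\<rbrakk>
        \<Longrightarrow> F\<^sub>m (MTen C f f') = MTen D (F\<^sub>m f) (F\<^sub>m f')"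

definition strict_monoidal_isomorphic ::
  "('o, 'm, 'k::field) lin_mon_cat \<Rightarrow> ('p, 'n, 'k) lin_mon_cat \<Rightarrow> bool" where
  "strict_monoidal_isomorphic C D \<longleftrightarrow>
    (\<exists>F\<^sub>o F\<^sub>m G\<^sub>o G\<^sub>m.
      strict_monoidal_lin_functor C D F\<^sub>o F\<^sub>m \<and> strict_monoidal_lin_functor D C G\<^sub>o G\<^sub>m \<and>
      (\<forall>X\<in>Obj C. G\<^sub>o (F\<^sub>o X) = X) \<and> (\<forall>X\<in>Obj D. F\<^sub>o (G\<^sub>o X) = X) \<and>
      (\<forall>X\<in>Obj C. \<forall>Y\<in>Obj C. \<forall>f\<in>Hom C X Y. G\<^sub>m (F\<^sub>m f) = f) \<and>
      (\<forall>X\<in>Obj D. \<forall>Y\<in>Obj D. \<forall>f\<in>Hom D X Y. F\<^sub>m (G\<^sub>m f) = f))"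


section \<open>Presentations by generators and relations\<close>

text \<open>
  Formal expressions for morphisms of a linear strict monoidal category with one generating
  object. The object \<open>m\<close> stands for the \<open>m\<close>-th tensor power of that object, so the objects are
  the natural numbers with addition as tensor product. \<open>g \<cdot> f\<close> is \<open>g\<close> after \<open>f\<close>.
\<close>

datatype ('g, 'k) expr =
    Gen 'g
  | Idn nat
  | Comp "('g, 'k) expr" "('g, 'k) expr"  (infixr \<open>\<cdot>\<close> 72)
  | Tens "('g, 'k) expr" "('g, 'k) expr"  (infixr \<open>\<odot>\<close> 76)
  | Null nat nat
  | Plus "('g, 'k) expr" "('g, 'k) expr"
  | Scale 'k "('g, 'k) expr"

text \<open>
  \<open>src\<close> and \<open>tgt\<close> give the source and target of each generator; a pair \<open>(s, t)\<close> in \<open>rels\<close>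
  stands for the defining relation \<open>s = t\<close>.
\<close>

record ('g, 'k) presentation =
  src  :: "'g \<Rightarrow> nat"
  tgt  :: "'g \<Rightarrow> nat"
  rels :: "(('g, 'k) expr \<times> ('g, 'k) expr) set"

inductive typed :: "('g, 'k) presentation \<Rightarrow> nat \<Rightarrow> nat \<Rightarrow> ('g, 'k) expr \<Rightarrow> bool"
  for P where
    typed_Gen: "typed P (src P x) (tgt P x) (Gen x)"
  | typed_Idn: "typed P m m (Idn m)"
  | typed_Comp: "\<lbrakk>typed P m n f; typed P n p g\<rbrakk> \<Longrightarrow> typed P m p (g \<cdot> f)"
  | typed_Tens: "\<lbrakk>typed P m n f; typed P m' n' f'\<rbrakk> \<Longrightarrow> typed P (m + m') (n + n') (f \<odot> f')"
  | typed_Null: "typed P m n (Null m n)"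
  | typed_Plus: "\<lbrakk>typed P m n f; typed P m n g\<rbrakk> \<Longrightarrow> typed P m n (Plus f g)"
  | typed_Scale: "typed P m n f \<Longrightarrow> typed P m n (Scale a f)"

text \<open>
  \<open>eqv P m n s t\<close>: the well-typed expressions \<open>s\<close> and \<open>t\<close> from \<open>m\<close> to \<open>n\<close> are equal
  modulo the relations of \<open>P\<close> and the axioms of linear strict monoidal categories.
\<close>

inductive eqv ::
  "('g, 'k::field) presentation \<Rightarrow> nat \<Rightarrow> nat \<Rightarrow> ('g, 'k) expr \<Rightarrow> ('g, 'k) expr \<Rightarrow> bool"
  for P where
    eqv_rel: "\<lbrakk>(s, t) \<in> rels P; typed P m n s; typed P m n t\<rbrakk> \<Longrightarrow> eqv P m n s t"
  | eqv_refl: "typed P m n s \<Longrightarrow> eqv P m n s s"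
  | eqv_sym: "eqv P m n s t \<Longrightarrow> eqv P m n t s"
  | eqv_trans: "\<lbrakk>eqv P m n s t; eqv P m n t u\<rbrakk> \<Longrightarrow> eqv P m n s u"
  | eqv_Comp: "\<lbrakk>eqv P m n f g; eqv P n p h k\<rbrakk> \<Longrightarrow> eqv P m p (h \<cdot> f) (k \<cdot> g)"
  | eqv_Tens:
      "\<lbrakk>eqv P m n f g; eqv P m' n' f' g'\<rbrakk> \<Longrightarrow> eqv P (m + m') (n + n') (f \<odot> f') (g \<odot> g')"
  | eqv_Plus: "\<lbrakk>eqv P m n f g; eqv P m n h k\<rbrakk> \<Longrightarrow> eqv P m n (Plus f h) (Plus g k)"
  | eqv_Scale: "eqv P m n f g \<Longrightarrow> eqv P m n (Scale a f) (Scale a g)"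
  | eqv_Idn_left: "typed P m n f \<Longrightarrow> eqv P m n (Idn n \<cdot> f) f"
  | eqv_Idn_right: "typed P m n f \<Longrightarrow> eqv P m n (f \<cdot> Idn m) f"
  | eqv_Comp_assoc:
      "\<lbrakk>typed P m n f; typed P n p g; typed P p q h\<rbrakk> \<Longrightarrow> eqv P m q ((h \<cdot> g) \<cdot> f) (h \<cdot> (g \<cdot> f))"
  | eqv_Tens_Idn: "eqv P (m + n) (m + n) (Idn m \<odot> Idn n) (Idn (m + n))"
  | eqv_interchange:
      "\<lbrakk>typed P m n f; typed P n p g; typed P m' n' f'; typed P n' p' g'\<rbrakk>
        \<Longrightarrow> eqv P (m + m') (p + p') ((g \<odot> g') \<cdot> (f \<odot> f')) ((g \<cdot> f) \<odot> (g' \<cdot> f'))"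
  | eqv_Tens_assoc:
      "\<lbrakk>typed P m n f; typed P m' n' f'; typed P m'' n'' f''\<rbrakk>
        \<Longrightarrow> eqv P (m + m' + m'') (n + n' + n'') ((f \<odot> f') \<odot> f'') (f \<odot> (f' \<odot> f''))"
  | eqv_Tens_unit_left: "typed P m n f \<Longrightarrow> eqv P m n (Idn 0 \<odot> f) f"
  | eqv_Tens_unit_right: "typed P m n f \<Longrightarrow> eqv P m n (f \<odot> Idn 0) f"
  | eqv_Plus_assoc:
      "\<lbrakk>typed P m n f; typed P m n g; typed P m n h\<rbrakk>
        \<Longrightarrow> eqv P m n (Plus (Plus f g) h) (Plus f (Plus g h))"
  | eqv_Plus_commute: "\<lbrakk>typed P m n f; typed P m n g\<rbrakk> \<Longrightarrow> eqv P m n (Plus f g) (Plus g f)"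
  | eqv_Plus_Null: "typed P m n f \<Longrightarrow> eqv P m n (Plus f (Null m n)) f"
  | eqv_Plus_inverse: "typed P m n f \<Longrightarrow> eqv P m n (Plus f (Scale (- 1) f)) (Null m n)"
  | eqv_Scale_one: "typed P m n f \<Longrightarrow> eqv P m n (Scale 1 f) f"
  | eqv_Scale_Scale: "typed P m n f \<Longrightarrow> eqv P m n (Scale a (Scale b f)) (Scale (a * b) f)"
  | eqv_Scale_Plus:
      "\<lbrakk>typed P m n f; typed P m n g\<rbrakk>
        \<Longrightarrow> eqv P m n (Scale a (Plus f g)) (Plus (Scale a f) (Scale a g))"
  | eqv_Plus_Scale:
      "typed P m n f \<Longrightarrow> eqv P m n (Scale (a + b) f) (Plus (Scale a f) (Scale b f))"
  | eqv_Comp_Plus_left: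
      "\<lbrakk>typed P m n f; typed P n p g; typed P n p h\<rbrakk>
        \<Longrightarrow> eqv P m p (Plus g h \<cdot> f) (Plus (g \<cdot> f) (h \<cdot> f))"
  | eqv_Comp_Plus_right:
      "\<lbrakk>typed P m n f; typed P m n g; typed P n p h\<rbrakk>
        \<Longrightarrow> eqv P m p (h \<cdot> Plus f g) (Plus (h \<cdot> f) (h \<cdot> g))"
  | eqv_Comp_Scale_left:
      "\<lbrakk>typed P m n f; typed P n p g\<rbrakk> \<Longrightarrow> eqv P m p (Scale a g \<cdot> f) (Scale a (g \<cdot> f))"
  | eqv_Comp_Scale_right:
      "\<lbrakk>typed P m n f; typed P n p g\<rbrakk> \<Longrightarrow> eqv P m p (g \<cdot> Scale a f) (Scale a (g \<cdot> f))"
  | eqv_Tens_Plus_left: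
      "\<lbrakk>typed P m n f; typed P m n g; typed P m' n' f'\<rbrakk>
        \<Longrightarrow> eqv P (m + m') (n + n') (Plus f g \<odot> f') (Plus (f \<odot> f') (g \<odot> f'))"
  | eqv_Tens_Plus_right:
      "\<lbrakk>typed P m n f; typed P m' n' f'; typed P m' n' g'\<rbrakk>
        \<Longrightarrow> eqv P (m + m') (n + n') (f \<odot> Plus f' g') (Plus (f \<odot> f') (f \<odot> g'))"
  | eqv_Tens_Scale_left:
      "\<lbrakk>typed P m n f; typed P m' n' f'\<rbrakk>
        \<Longrightarrow> eqv P (m + m') (n + n') (Scale a f \<odot> f') (Scale a (f \<odot> f'))"
  | eqv_Tens_Scale_right:
      "\<lbrakk>typed P m n f; typed P m' n' f'\<rbrakk>
        \<Longrightarrow> eqv P (m + m') (n + n') (f \<odot> Scale a f') (Scale a (f \<odot> f'))"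

definition eqv_class ::
  "('g, 'k::field) presentation \<Rightarrow> nat \<Rightarrow> nat \<Rightarrow> ('g, 'k) expr \<Rightarrow> ('g, 'k) expr set" where
  "eqv_class P m n t = {s. eqv P m n s t}"

text \<open>
  Morphisms are equivalence classes of well-typed expressions. An operation on classes collects
  all expressions equivalent to the operation applied to members; by congruence and uniqueness
  of types this is the class of the result for any choice of representatives.
\<close>

definition presented_cat ::
  "('g, 'k::field) presentation \<Rightarrow> (nat, ('g, 'k) expr set, 'k) lin_mon_cat" where
  "presented_cat P =
    \<lparr> Obj = UNIV,
      Hom = (\<lambda>m n. eqv_class P m n ` {t. typed P m n t}),
      Ide = (\<lambda>m. eqv_class P m m (Idn m)),
      Cmp = (\<lambda>G F. {t. \<exists>m n. \<exists>g\<in>G. \<exists>f\<in>F. eqv P m n t (g \<cdot> f)}),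
      Add = (\<lambda>F G. {t. \<exists>m n. \<exists>f\<in>F. \<exists>g\<in>G. eqv P m n t (Plus f g)}),
      Zer = (\<lambda>m n. eqv_class P m n (Null m n)),
      Scl = (\<lambda>a F. {t. \<exists>m n. \<exists>f\<in>F. eqv P m n t (Scale a f)}),
      Unt = 0,
      OTen = (+),
      MTen = (\<lambda>F G. {t. \<exists>m n. \<exists>f\<in>F. \<exists>g\<in>G. eqv P m n t (f \<odot> g)}) \<rparr>"


section \<open>The two categories\<close>

datatype brauer_gen = Cross | Cap | Cup

primrec gen_src :: "brauer_gen \<Rightarrow> nat" where
  "gen_src Cross = 2"
| "gen_src Cap = 2"
| "gen_src Cup = 0"

primrec gen_tgt :: "brauer_gen \<Rightarrow> nat" where
  "gen_tgt Cross = 2"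
| "gen_tgt Cap = 0"
| "gen_tgt Cup = 2"

abbreviation HH :: "(brauer_gen, 'k) expr" where "HH \<equiv> Gen Cross"
abbreviation AA :: "(brauer_gen, 'k) expr" where "AA \<equiv> Gen Cap"
abbreviation UU :: "(brauer_gen, 'k) expr" where "UU \<equiv> Gen Cup"
abbreviation II :: "(brauer_gen, 'k) expr" where "II \<equiv> Idn 1"

text \<open>The scalar \<open>\<delta>\<close> in \<open>AU = \<delta>\<close> is \<open>\<delta>\<close> times the identity of the unit object.\<close>

definition brauer_type_rels ::
  "'k::field \<Rightarrow> ((brauer_gen, 'k) expr \<times> (brauer_gen, 'k) expr) set" where
  "brauer_type_rels \<delta> =
    { (HH \<cdot> UU, UU),
      (AA \<cdot> HH, AA),
      (AA \<cdot> UU, Scale \<delta> (Idn 0)),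
      ((AA \<odot> II) \<cdot> (II \<odot> UU), II),
      ((II \<odot> AA) \<cdot> (UU \<odot> II), II),
      ((AA \<odot> II) \<cdot> (II \<odot> HH) \<cdot> (UU \<odot> II), II),
      (HH \<cdot> HH, Idn 2),
      ((HH \<odot> II) \<cdot> (II \<odot> UU), (II \<odot> HH) \<cdot> (UU \<odot> II)),
      ((HH \<odot> II) \<cdot> (II \<odot> HH) \<cdot> (UU \<odot> II), II \<odot> UU),
      ((II \<odot> AA) \<cdot> (HH \<odot> II), (AA \<odot> II) \<cdot> (II \<odot> HH)),
      ((AA \<odot> II) \<cdot> (II \<odot> HH) \<cdot> (HH \<odot> II), II \<odot> AA),
      ((HH \<odot> II) \<cdot> (II \<odot> HH) \<cdot> (HH \<odot> II), (II \<odot> HH) \<cdot> (HH \<odot> II) \<cdot> (II \<odot> HH)) }"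

definition brauer_rels ::
  "'k::field \<Rightarrow> ((brauer_gen, 'k) expr \<times> (brauer_gen, 'k) expr) set" where
  "brauer_rels \<delta> =
    { (HH \<cdot> HH, Idn 2),
      ((HH \<odot> II) \<cdot> (II \<odot> HH) \<cdot> (HH \<odot> II), (II \<odot> HH) \<cdot> (HH \<odot> II) \<cdot> (II \<odot> HH)),
      ((AA \<odot> II) \<cdot> (II \<odot> UU), II),
      ((II \<odot> AA) \<cdot> (UU \<odot> II), II),
      ((II \<odot> HH) \<cdot> (UU \<odot> II), (HH \<odot> II) \<cdot> (II \<odot> UU)),
      (HH \<cdot> UU, UU),
      (AA \<cdot> UU, Scale \<delta> (Idn 0)) }"

text \<open>The category $\mathcal{C}^{0,0}_{1,1}(+,1,1)$ with $\varsigma = \lambda = 1$.\<close>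

definition brauer_type_cat ::
  "'k::field \<Rightarrow> (nat, (brauer_gen, 'k) expr set, 'k) lin_mon_cat" where
  "brauer_type_cat \<delta> =
    presented_cat \<lparr>src = gen_src, tgt = gen_tgt, rels = brauer_type_rels \<delta>\<rparr>"

text \<open>The Brauer category $\mathcal{B}(+1)$ with loop parameter \<open>\<delta>\<close>.\<close>

definition brauer_cat ::
  "'k::field \<Rightarrow> (nat, (brauer_gen, 'k) expr set, 'k) lin_mon_cat" where
  "brauer_cat \<delta> = presented_cat \<lparr>src = gen_src, tgt = gen_tgt, rels = brauer_rels \<delta>\<rparr>"

end

theory Submission
  imports Defs
begin

text \<open>
  Every relation of the Brauer category is a relation of the category of Brauer type. Conversely,
  a morphism with source \<open>m + 1\<close> is determined by what it becomes after its last input is bent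
  around with a cup. Both sides of \<open>(I \<odot> A) \<cdot> (H \<odot> I) = (A \<odot> I) \<cdot> (I \<odot> H)\<close> bend to \<open>H\<close>, so this
  relation holds in the Brauer category. Together with \<open>HU = U\<close> it gives the twist relation
  \<open>(A \<odot> I) \<cdot> (I \<odot> H) \<cdot> (U \<odot> I) = I\<close>, which says that \<open>AH\<close> and \<open>A\<close> bend to the same morphism; the
  remaining relations follow with \<open>H\<^sup>2 = 1\<close>. The two presentations thus define the same
  congruence, and the two categories are equal.
\<close>

section \<open>Typing of expressions by recursion\<close>

primrec expr_src :: "('g, 'k) presentation \<Rightarrow> ('g, 'k) expr \<Rightarrow> nat" where
  "expr_src P (Gen x) = src P x"
| "expr_src P (Idn m) = m"
| "expr_src P (g \<cdot> f) = expr_src P f"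
| "expr_src P (f \<odot> g) = expr_src P f + expr_src P g"
| "expr_src P (Null m n) = m"
| "expr_src P (Plus f g) = expr_src P f"
| "expr_src P (Scale a f) = expr_src P f"

primrec expr_tgt :: "('g, 'k) presentation \<Rightarrow> ('g, 'k) expr \<Rightarrow> nat" where
  "expr_tgt P (Gen x) = tgt P x"
| "expr_tgt P (Idn m) = m"
| "expr_tgt P (g \<cdot> f) = expr_tgt P g"
| "expr_tgt P (f \<odot> g) = expr_tgt P f + expr_tgt P g"
| "expr_tgt P (Null m n) = n"
| "expr_tgt P (Plus f g) = expr_tgt P f"
| "expr_tgt P (Scale a f) = expr_tgt P f"

primrec well_typed :: "('g, 'k) presentation \<Rightarrow> ('g, 'k) expr \<Rightarrow> bool" where
  "well_typed P (Gen x) \<longleftrightarrow> True"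
| "well_typed P (Idn m) \<longleftrightarrow> True"
| "well_typed P (g \<cdot> f) \<longleftrightarrow> well_typed P g \<and> well_typed P f \<and> expr_src P g = expr_tgt P f"
| "well_typed P (f \<odot> g) \<longleftrightarrow> well_typed P f \<and> well_typed P g"
| "well_typed P (Null m n) \<longleftrightarrow> True"
| "well_typed P (Plus f g) \<longleftrightarrow> well_typed P f \<and> well_typed P g \<and>
    expr_src P f = expr_src P g \<and> expr_tgt P f = expr_tgt P g"
| "well_typed P (Scale a f) \<longleftrightarrow> well_typed P f"

text \<open>Each expression has at most one type, and recursion computes it. Typing conditions
  thereby become goals for the simplifier, and uniqueness of types comes for free.\<close>

lemma typed_iff: "typed P m n t \<longleftrightarrow> well_typed P t \<and> m = expr_src P t \<and> n = expr_tgt P t"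
proof
  show "typed P m n t \<Longrightarrow> well_typed P t \<and> m = expr_src P t \<and> n = expr_tgt P t"
    by (induction rule: typed.induct) auto
  have "well_typed P t \<Longrightarrow> typed P (expr_src P t) (expr_tgt P t) t"
    by (induction t) (simp; metis typed.intros)+
  then show "well_typed P t \<and> m = expr_src P t \<and> n = expr_tgt P t \<Longrightarrow> typed P m n t"
    by blast
qed

lemma eqv_typed: "eqv P m n s t \<Longrightarrow> typed P m n s \<and> typed P m n t"
  by (induction rule: eqv.induct) (auto simp: typed_iff)

text \<open>
  Quantifying over the type makes the class of an ill-typed expression empty, so the
  associativity laws hold for these classes without typing assumptions.
\<close>

definition expr_class :: "('g, 'k::field) presentation \<Rightarrow> ('g, 'k) expr \<Rightarrow> ('g, 'k) expr set" where
  "expr_class P t = {s. \<exists>m n. eqv P m n s t}"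

lemma eqv_class_eq: "typed P m n t \<Longrightarrow> eqv_class P m n t = expr_class P t"
  unfolding eqv_class_def expr_class_def by (auto; metis eqv_typed typed_iff)

lemma eqv_rels:
  assumes "(s, t) \<in> rels P \<or> (t, s) \<in> rels P" "typed P m n s" "typed P m n t"
  shows "eqv P m n s t"
  using assms eqv_rel eqv_sym by metis

lemma expr_class_eqI: "eqv P m n s t \<Longrightarrow> expr_class P s = expr_class P t"
  unfolding expr_class_def
  by (auto; metis eqv_typed typed_iff eqv_trans eqv_sym)

lemma expr_class_self: "well_typed P t \<Longrightarrow> t \<in> expr_class P t"
  unfolding expr_class_def using eqv_refl typed_iff by blast

text \<open>Equal classes put \<open>s\<close> into the class of \<open>t\<close>, so
  \<open>s\<close> and \<open>t\<close> are congruent at some type; uniqueness of types forces this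
  type to be that of \<open>s\<close>. This is why no typing of \<open>t\<close> has to be
  assumed.\<close>

lemma expr_class_eq_iff:
  assumes "typed P m n s"
  shows "expr_class P s = expr_class P t \<longleftrightarrow> eqv P m n s t"
proof
  assume "expr_class P s = expr_class P t"
  moreover have "s \<in> expr_class P s"
    using assms by (simp add: expr_class_self typed_iff)
  ultimately obtain m' n' where "eqv P m' n' s t"
    unfolding expr_class_def by blast
  then show "eqv P m n s t"
    using assms eqv_typed typed_iff by metis
qed (rule expr_class_eqI)

lemma expr_class_ill_typed: "\<not> well_typed P t \<Longrightarrow> expr_class P t = {}"
  unfolding expr_class_def using eqv_typed typed_iff by blast

section \<open>Presented categories computed on representatives\<close>

context
  fixes P :: "('g, 'k::field) presentation"
begin

abbreviation cls :: "('g, 'k) expr \<Rightarrow> ('g, 'k) expr set" where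
  "cls \<equiv> expr_class P"

lemma Hom_presented_cat: "Hom (presented_cat P) m n = cls ` {t. typed P m n t}"
  by (auto simp: presented_cat_def eqv_class_eq)

lemma Ide_presented_cat: "Ide (presented_cat P) m = cls (Idn m)"
  by (simp add: presented_cat_def eqv_class_eq typed_Idn)

lemma Zer_presented_cat: "Zer (presented_cat P) m n = cls (Null m n)"
  by (simp add: presented_cat_def eqv_class_eq typed_Null)

text \<open>All members of a class have the type of its representative. For a well-typed composite,
  congruence makes the choice of members irrelevant; for an ill-typed one no choice of members is
  composable, and both sides are empty. The other operations follow the same pattern.\<close>

lemma Cmp_presented_cat: "Cmp (presented_cat P) (cls g) (cls f) = cls (g \<cdot> f)"
proof (cases "well_typed P (g \<cdot> f)")
  case True
  then have "g \<in> cls g" "f \<in> cls f"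
    by (auto intro: expr_class_self)
  moreover have "eqv P m n t (g \<cdot> f)"
    if t: "eqv P m n t (g' \<cdot> f')" "g' \<in> cls g" "f' \<in> cls f" for t g' f' m n
  proof -
    obtain a b c d where eqvs: "eqv P a b g' g" "eqv P c d f' f"
      using t(2,3) unfolding expr_class_def by blast
    have "b = n" "a = d" "c = m"
      using eqv_typed[OF t(1)] eqv_typed[OF eqvs(1)] eqv_typed[OF eqvs(2)] True
      by (auto simp: typed_iff)
    then show ?thesis
      using t(1) eqvs eqv_Comp eqv_trans by blast
  qed
  ultimately show ?thesis
    unfolding presented_cat_def expr_class_def[of P "g \<cdot> f"] by (simp; blast)
next
  case False
  moreover have "\<not> eqv P m n t (g' \<cdot> f')"
    if t: "eqv P a b g' g" "eqv P c d f' f" for t g' f' m n a b c d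
    using eqv_typed[OF t(1)] eqv_typed[OF t(2)] False eqv_typed[of P m n t "g' \<cdot> f'"]
    by (auto simp: typed_iff)
  ultimately show ?thesis
    by (auto simp: presented_cat_def expr_class_ill_typed) (auto simp: expr_class_def)
qed

lemma MTen_presented_cat: "MTen (presented_cat P) (cls f) (cls g) = cls (f \<odot> g)"
proof (cases "well_typed P (f \<odot> g)")
  case True
  then have "f \<in> cls f" "g \<in> cls g"
    by (auto intro: expr_class_self)
  moreover have "eqv P m n t (f \<odot> g)"
    if t: "eqv P m n t (f' \<odot> g')" "f' \<in> cls f" "g' \<in> cls g" for t f' g' m n
  proof -
    obtain a b c d where eqvs: "eqv P a b f' f" "eqv P c d g' g"
      using t(2,3) unfolding expr_class_def by blast
    have "m = a + c" "n = b + d"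
      using eqv_typed[OF t(1)] eqv_typed[OF eqvs(1)] eqv_typed[OF eqvs(2)]
      by (auto simp: typed_iff)
    then show ?thesis
      using t(1) eqvs eqv_Tens eqv_trans by blast
  qed
  ultimately show ?thesis
    unfolding presented_cat_def expr_class_def[of P "f \<odot> g"] by (simp; blast)
next
  case False
  moreover have "\<not> eqv P m n t (f' \<odot> g')"
    if t: "eqv P a b f' f" "eqv P c d g' g" for t f' g' m n a b c d
    using eqv_typed[OF t(1)] eqv_typed[OF t(2)] False eqv_typed[of P m n t "f' \<odot> g'"]
    by (auto simp: typed_iff)
  ultimately show ?thesis
    by (auto simp: presented_cat_def expr_class_ill_typed)
qed

lemma Add_presented_cat: "Add (presented_cat P) (cls f) (cls g) = cls (Plus f g)"
proof (cases "well_typed P (Plus f g)")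
  case True
  then have "f \<in> cls f" "g \<in> cls g"
    by (auto intro: expr_class_self)
  moreover have "eqv P m n t (Plus f g)"
    if t: "eqv P m n t (Plus f' g')" "f' \<in> cls f" "g' \<in> cls g" for t f' g' m n
  proof -
    obtain a b c d where eqvs: "eqv P a b f' f" "eqv P c d g' g"
      using t(2,3) unfolding expr_class_def by blast
    have "a = m" "b = n" "c = m" "d = n"
      using eqv_typed[OF t(1)] eqv_typed[OF eqvs(1)] eqv_typed[OF eqvs(2)]
      by (auto simp: typed_iff)
    then show ?thesis
      using t(1) eqvs eqv_Plus eqv_trans by blast
  qed
  ultimately show ?thesis
    unfolding presented_cat_def expr_class_def[of P "Plus f g"] by (simp; blast)
next
  case False
  moreover have "\<not> eqv P m n t (Plus f' g')"
    if t: "eqv P a b f' f" "eqv P c d g' g" for t f' g' m n a b c d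
    using eqv_typed[OF t(1)] eqv_typed[OF t(2)] False eqv_typed[of P m n t "Plus f' g'"]
    by (auto simp: typed_iff)
  ultimately show ?thesis
    by (auto simp: presented_cat_def expr_class_ill_typed) (auto simp: expr_class_def)
qed

lemma Scl_presented_cat: "Scl (presented_cat P) a (cls f) = cls (Scale a f)"
proof (cases "well_typed P f")
  case True
  then have "f \<in> cls f"
    by (auto intro: expr_class_self)
  moreover have "eqv P m n t (Scale a f)"
    if t: "eqv P m n t (Scale a f')" "f' \<in> cls f" for t f' m n
  proof -
    obtain b c where eqv: "eqv P b c f' f"
      using t(2) unfolding expr_class_def by blast
    have "b = m" "c = n"
      using eqv_typed[OF t(1)] eqv_typed[OF eqv] by (auto simp: typed_iff)
    then show ?thesis
      using t(1) eqv eqv_Scale eqv_trans by blast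
  qed
  ultimately show ?thesis
    unfolding presented_cat_def expr_class_def[of P "Scale a f"] by (simp; blast)
next
  case False
  then show ?thesis
    using expr_class_ill_typed[of P f] expr_class_ill_typed[of P "Scale a f"]
    by (simp add: presented_cat_def)
qed

lemma Obj_presented_cat: "Obj (presented_cat P) = UNIV"
  and Unt_presented_cat: "Unt (presented_cat P) = 0"
  and OTen_presented_cat: "OTen (presented_cat P) = (+)"
  by (simp_all add: presented_cat_def)

lemmas presented_cat_simps =
  Hom_presented_cat Ide_presented_cat Zer_presented_cat Cmp_presented_cat MTen_presented_cat
  Add_presented_cat Scl_presented_cat Obj_presented_cat Unt_presented_cat OTen_presented_cat

text \<open>Closure axioms are typing rules and equational axioms are rules of \<open>eqv\<close>.
  Only disjointness of hom-sets, which is uniqueness of types, and the existential axiom of additive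
  inverses need an argument of their own.\<close>

lemma strict_monoidal_lin_category_presented_cat:
  "strict_monoidal_lin_category (presented_cat P)"
proof
  fix X Y X' Y' f
  assume "f \<in> Hom (presented_cat P) X Y" "f \<in> Hom (presented_cat P) X' Y'"
  then obtain s t where "typed P X Y s" "typed P X' Y' t" "cls s = cls t"
    by (auto simp: Hom_presented_cat)
  then show "X = X' \<and> Y = Y'"
    using expr_class_eq_iff eqv_typed typed_iff by metis
next
  fix X Y f assume "f \<in> Hom (presented_cat P) X Y"
  then obtain s where "typed P X Y s" "f = cls s"
    by (auto simp: Hom_presented_cat)
  then show "\<exists>g\<in>Hom (presented_cat P) X Y.
      Add (presented_cat P) f g = Zer (presented_cat P) X Y"
    by (intro bexI[of _ "cls (Scale (- 1) s)"])
      (auto simp: presented_cat_simps expr_class_eqI[OF eqv_Plus_inverse] intro: typed.intros)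
qed (clarsimp simp: presented_cat_simps;
  (rule imageI, rule CollectI, rule typed.intros; assumption |
   rule expr_class_eqI, rule eqv.intros; assumption))+

section \<open>Equational calculus of classes\<close>

lemma cls_Comp_cong:
  "\<lbrakk>cls g = cls g'; cls f = cls f'\<rbrakk>
    \<Longrightarrow> cls (g \<cdot> f) = cls (g' \<cdot> f')"
  by (metis Cmp_presented_cat)

lemma cls_Tens_cong:
  "\<lbrakk>cls f = cls f'; cls g = cls g'\<rbrakk>
    \<Longrightarrow> cls (f \<odot> g) = cls (f' \<odot> g')"
  by (metis MTen_presented_cat)

lemma cls_Comp_assoc: "cls ((h \<cdot> g) \<cdot> f) = cls (h \<cdot> g \<cdot> f)"
proof (cases "well_typed P (h \<cdot> g \<cdot> f)")
  case True
  then show ?thesis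
    by (intro expr_class_eqI[OF eqv_Comp_assoc]) (auto simp: typed_iff)
next
  case False
  then show ?thesis
    by (auto simp: expr_class_ill_typed)
qed

lemma cls_Tens_assoc: "cls ((f \<odot> g) \<odot> h) = cls (f \<odot> g \<odot> h)"
proof (cases "well_typed P (f \<odot> g \<odot> h)")
  case True
  then show ?thesis
    by (intro expr_class_eqI[OF eqv_Tens_assoc]) (auto simp: typed_iff)
next
  case False
  then show ?thesis
    by (auto simp: expr_class_ill_typed)
qed

lemma cls_Comp_Idn: "well_typed P f \<Longrightarrow> expr_src P f = m \<Longrightarrow> cls (f \<cdot> Idn m) = cls f"
  by (rule expr_class_eqI[OF eqv_Idn_right]) (auto simp: typed_iff)

lemma cls_Idn_Comp: "well_typed P f \<Longrightarrow> expr_tgt P f = m \<Longrightarrow> cls (Idn m \<cdot> f) = cls f"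
  by (rule expr_class_eqI[OF eqv_Idn_left]) (auto simp: typed_iff)

lemma cls_Tens_Idn: "cls (Idn m \<odot> Idn n) = cls (Idn (m + n))"
  by (rule expr_class_eqI[OF eqv_Tens_Idn])

text \<open>The assumptions exclude tensors whose total types match although those of the factors do
  not: there the left side can be well-typed while the right side is not.\<close>

lemma cls_interchange:
  assumes "expr_src P g = expr_tgt P f" "expr_src P g' = expr_tgt P f'"
  shows "cls ((g \<odot> g') \<cdot> (f \<odot> f')) = cls ((g \<cdot> f) \<odot> (g' \<cdot> f'))"
proof (cases "well_typed P ((g \<cdot> f) \<odot> (g' \<cdot> f'))")
  case True
  then show ?thesis
    by (intro expr_class_eqI[OF eqv_interchange]) (auto simp: typed_iff)
next
  case False
  then show ?thesis
    using assms by (auto simp: expr_class_ill_typed)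
qed

text \<open>Both sides are \<open>f \<odot> g\<close> by interchange, because \<open>f\<close> and
  \<open>g\<close> act on disjoint strands. The widths are variables tied by equations, so that the
  rule matches numerals such as \<open>Idn 2\<close> and \<open>Idn 0\<close>.\<close>

lemma cls_slide:
  assumes "well_typed P f" "well_typed P g"
    and "m = expr_src P f" "n = expr_tgt P f" "p = expr_src P g" "q = expr_tgt P g"
  shows "cls ((Idn n \<odot> g) \<cdot> (f \<odot> Idn p)) = cls ((f \<odot> Idn q) \<cdot> (Idn m \<odot> g))"
proof -
  have "cls ((Idn n \<odot> g) \<cdot> (f \<odot> Idn p)) = cls ((Idn n \<cdot> f) \<odot> (g \<cdot> Idn p))"
    using assms by (intro cls_interchange) auto
  also have "\<dots> = cls ((f \<cdot> Idn m) \<odot> (Idn q \<cdot> g))"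
    using assms by (intro cls_Tens_cong) (simp_all add: cls_Comp_Idn cls_Idn_Comp)
  also have "\<dots> = cls ((f \<odot> Idn q) \<cdot> (Idn m \<odot> g))"
    using assms by (intro cls_interchange[symmetric]) auto
  finally show ?thesis .
qed

section \<open>Adding strands and bending inputs\<close>

abbreviation lft :: "('g, 'k) expr \<Rightarrow> ('g, 'k) expr" where "lft f \<equiv> Idn 1 \<odot> f"
abbreviation rgt :: "('g, 'k) expr \<Rightarrow> ('g, 'k) expr" where "rgt f \<equiv> f \<odot> Idn 1"

text \<open>Interchange, with the added strand written as \<open>Idn 1 \<cdot> Idn 1\<close>. An
  extra strand on both factors cannot repair a type mismatch, so in the ill-typed case both classes
  are empty.\<close>

lemma cls_lft_Comp: "cls (lft (g \<cdot> f)) = cls (lft g \<cdot> lft f)"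
proof -
  have "cls (lft (g \<cdot> f)) = cls ((Idn 1 \<cdot> Idn 1) \<odot> (g \<cdot> f))"
    by (intro cls_Tens_cong) (simp_all add: cls_Comp_Idn)
  also have "\<dots> = cls (lft g \<cdot> lft f)"
    by (cases "expr_src P g = expr_tgt P f") (auto simp: cls_interchange expr_class_ill_typed)
  finally show ?thesis .
qed

lemma cls_rgt_Comp: "cls (rgt (g \<cdot> f)) = cls (rgt g \<cdot> rgt f)"
proof -
  have "cls (rgt (g \<cdot> f)) = cls ((g \<cdot> f) \<odot> (Idn 1 \<cdot> Idn 1))"
    by (intro cls_Tens_cong) (simp_all add: cls_Comp_Idn)
  also have "\<dots> = cls (rgt g \<cdot> rgt f)"
    by (cases "expr_src P g = expr_tgt P f") (auto simp: cls_interchange expr_class_ill_typed)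
  finally show ?thesis .
qed

lemma cls_lft_lft: "cls (lft (lft f)) = cls (Idn 2 \<odot> f)"
proof -
  have "cls (Idn 2 \<odot> f) = cls ((Idn 1 \<odot> Idn 1) \<odot> f)"
    by (intro cls_Tens_cong refl) (simp add: cls_Tens_Idn numeral_2_eq_2)
  then show ?thesis
    by (simp add: cls_Tens_assoc)
qed

lemma cls_rgt_rgt: "cls (rgt (rgt f)) = cls (f \<odot> Idn 2)"
proof -
  have "cls (f \<odot> Idn 2) = cls (f \<odot> (Idn 1 \<odot> Idn 1))"
    by (intro cls_Tens_cong refl) (simp add: cls_Tens_Idn numeral_2_eq_2)
  then show ?thesis
    by (simp add: cls_Tens_assoc)
qed

text \<open>The cup \<open>u\<close> turns the last input of \<open>z\<close> into an extra output,
  and \<open>a\<close> caps this output against a fresh strand. Sliding \<open>a\<close> past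
  \<open>z\<close> brings it next to \<open>u\<close>; the snake relation then straightens the
  strand.\<close>

lemma cls_unbend:
  assumes "well_typed P z" "expr_src P z = Suc m" "expr_tgt P z = n"
    and a: "well_typed P a" "expr_src P a = 2" "expr_tgt P a = 0"
    and u: "well_typed P u" "expr_src P u = 0" "expr_tgt P u = 2"
    and snake: "cls (lft a \<cdot> rgt u) = cls (Idn 1)"
  shows "cls ((Idn n \<odot> a) \<cdot> rgt (rgt z \<cdot> (Idn m \<odot> u))) = cls z"
proof -
  have "cls (rgt (rgt z \<cdot> (Idn m \<odot> u))) =
      cls (rgt (rgt z) \<cdot> rgt (Idn m \<odot> u))"
    by (rule cls_rgt_Comp)
  also have "\<dots> = cls ((z \<odot> Idn 2) \<cdot> (Idn m \<odot> rgt u))"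
    by (rule cls_Comp_cong[OF cls_rgt_rgt cls_Tens_assoc])
  finally have "cls ((Idn n \<odot> a) \<cdot> rgt (rgt z \<cdot> (Idn m \<odot> u))) =
      cls ((Idn n \<odot> a) \<cdot> (z \<odot> Idn 2) \<cdot> (Idn m \<odot> rgt u))"
    by (rule cls_Comp_cong[OF refl])
  also have "\<dots> = cls (((Idn n \<odot> a) \<cdot> (z \<odot> Idn 2)) \<cdot> (Idn m \<odot> rgt u))"
    by (rule cls_Comp_assoc[symmetric])
  \<comment> \<open>Since \<open>a\<close> has target 0, it leaves only \<open>Idn 0\<close> beside
    \<open>z\<close> once it is applied first.\<close>
  also have "\<dots> = cls (((z \<odot> Idn 0) \<cdot> (Idn (Suc m) \<odot> a)) \<cdot> (Idn m \<odot> rgt u))"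
    using assms by (intro cls_Comp_cong[OF cls_slide refl]) auto
  also have "\<dots> = cls ((z \<odot> Idn 0) \<cdot> (Idn (Suc m) \<odot> a) \<cdot> (Idn m \<odot> rgt u))"
    by (rule cls_Comp_assoc)
  also have "\<dots> = cls (z \<cdot> Idn (Suc m))"
  proof (rule cls_Comp_cong)
    show "cls (z \<odot> Idn 0) = cls z"
      using assms by (intro expr_class_eqI[OF eqv_Tens_unit_right]) (simp add: typed_iff)
    \<comment> \<open>The last of the \<open>Suc m\<close> strands is split off: it is the only one
      that meets both \<open>a\<close> and \<open>u\<close>.\<close>
    have "cls (Idn (Suc m) \<odot> a) = cls ((Idn m \<odot> Idn 1) \<odot> a)"
      by (intro cls_Tens_cong refl) (simp add: cls_Tens_Idn)
    also have "\<dots> = cls (Idn m \<odot> lft a)"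
      by (rule cls_Tens_assoc)
    finally have "cls ((Idn (Suc m) \<odot> a) \<cdot> (Idn m \<odot> rgt u)) =
        cls ((Idn m \<odot> lft a) \<cdot> (Idn m \<odot> rgt u))"
      by (rule cls_Comp_cong[OF _ refl])
    also have "\<dots> = cls ((Idn m \<cdot> Idn m) \<odot> (lft a \<cdot> rgt u))"
      using a u by (intro cls_interchange) auto
    also have "\<dots> = cls (Idn m \<odot> Idn 1)"
      by (rule cls_Tens_cong[OF cls_Comp_Idn snake]) auto
    also have "\<dots> = cls (Idn (Suc m))"
      by (simp add: cls_Tens_Idn)
    finally show "cls ((Idn (Suc m) \<odot> a) \<cdot> (Idn m \<odot> rgt u)) =
        cls (Idn (Suc m))" .
  qed
  also have "\<dots> = cls z"
    using assms by (simp add: cls_Comp_Idn)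
  finally show ?thesis .
qed

text \<open>By \<open>cls_unbend\<close>, bending has a left inverse given by a formula in the bent
  morphism alone, so it is injective.\<close>

lemma cls_bend_inject:
  assumes "well_typed P z" "expr_src P z = Suc m"
    and "well_typed P w" "expr_src P w = Suc m" "expr_tgt P w = expr_tgt P z"
    and "well_typed P a" "expr_src P a = 2" "expr_tgt P a = 0"
    and "well_typed P u" "expr_src P u = 0" "expr_tgt P u = 2"
    and "cls (lft a \<cdot> rgt u) = cls (Idn 1)"
    and eq: "cls (rgt z \<cdot> (Idn m \<odot> u)) = cls (rgt w \<cdot> (Idn m \<odot> u))"
  shows "cls z = cls w"
proof -
  have "cls z =
      cls ((Idn (expr_tgt P z) \<odot> a) \<cdot> rgt (rgt z \<cdot> (Idn m \<odot> u)))"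
    using assms by (intro cls_unbend[symmetric]) auto
  also have "\<dots> = cls ((Idn (expr_tgt P z) \<odot> a) \<cdot> rgt (rgt w \<cdot> (Idn m \<odot> u)))"
    by (intro cls_Comp_cong cls_Tens_cong refl eq)
  also have "\<dots> = cls w"
    using assms by (intro cls_unbend) auto
  finally show ?thesis .
qed

end

section \<open>Comparison of presentations\<close>

lemma strict_monoidal_isomorphic_refl:
  assumes "strict_monoidal_lin_category C"
  shows "strict_monoidal_isomorphic C C"
proof -
  interpret strict_monoidal_lin_category C by fact
  have "strict_monoidal_lin_functor C C id id"
    by unfold_locales auto
  then show ?thesis
    unfolding strict_monoidal_isomorphic_def by (intro exI[of _ id]) auto
qed

text \<open>Typing depends only on \<open>src\<close> and \<open>tgt\<close>, so every rule except
  \<open>eqv_rel\<close> carries over from \<open>P\<close> to \<open>Q\<close> unchanged; the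
  assumption \<open>rels\<close> covers that one.\<close>

lemma eqv_rels_mono:
  assumes "eqv P m n s t" and "src P = src Q" "tgt P = tgt Q"
    and rels: "\<And>s t m n. (s, t) \<in> rels P \<Longrightarrow> typed Q m n s \<Longrightarrow> typed Q m n t \<Longrightarrow> eqv Q m n s t"
  shows "eqv Q m n s t"
proof -
  have src_eq: "expr_src P t = expr_src Q t" and tgt_eq: "expr_tgt P t = expr_tgt Q t" for t
    using assms(2,3) by (induction t) auto
  have "well_typed P t = well_typed Q t" for t
    by (induction t) (auto simp: src_eq tgt_eq)
  then have typed_eq: "typed P = typed Q"
    by (intro ext) (simp add: typed_iff src_eq tgt_eq)
  show ?thesis
    using assms(1)
    apply (induction rule: eqv.induct)
    unfolding typed_eq
    apply (rule rels eqv_refl; assumption)+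
    apply (rule eqv_sym; assumption)
    apply (rule eqv_trans; assumption)
    apply (rule eqv.intros; assumption)+
    done
qed

text \<open>Monotonicity in both directions makes the congruences equal. They determine
  \<open>typed\<close>, since \<open>t\<close> is congruent to itself exactly when it is well-typed,
  and \<open>presented_cat\<close> is built from these two predicates.\<close>

lemma presented_cat_eqI:
  assumes "src P = src Q" "tgt P = tgt Q"
    and "\<And>s t m n. (s, t) \<in> rels P \<Longrightarrow> typed Q m n s \<Longrightarrow> typed Q m n t \<Longrightarrow> eqv Q m n s t"
    and "\<And>s t m n. (s, t) \<in> rels Q \<Longrightarrow> typed P m n s \<Longrightarrow> typed P m n t \<Longrightarrow> eqv P m n s t"
  shows "presented_cat P = presented_cat Q"
proof -
  have eqv: "eqv P = eqv Q"
    by (intro ext iffI; erule eqv_rels_mono; simp add: assms)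
  then have "typed P = typed Q"
    by (intro ext) (metis eqv_refl eqv_typed)
  with eqv show ?thesis
    unfolding presented_cat_def eqv_class_def by simp
qed

section \<open>Derived relations in the Brauer category\<close>

context
  fixes \<delta> :: "'k::field"
begin

abbreviation brauer_pres :: "(brauer_gen, 'k) presentation" where
  "brauer_pres \<equiv> \<lparr>src = gen_src, tgt = gen_tgt, rels = brauer_rels \<delta>\<rparr>"

abbreviation bcls :: "(brauer_gen, 'k) expr \<Rightarrow> (brauer_gen, 'k) expr set" where
  "bcls \<equiv> expr_class brauer_pres"

lemma bcls_rel:
  assumes "(s, t) \<in> brauer_rels \<delta> \<or> (t, s) \<in> brauer_rels \<delta>"
    and "well_typed brauer_pres s" "well_typed brauer_pres t"
    and "expr_src brauer_pres s = expr_src brauer_pres t"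
    and "expr_tgt brauer_pres s = expr_tgt brauer_pres t"
  shows "bcls s = bcls t"
proof -
  let ?m = "expr_src brauer_pres s" and ?n = "expr_tgt brauer_pres s"
  have "typed brauer_pres ?m ?n s" "typed brauer_pres ?m ?n t"
    using assms by (simp_all add: typed_iff)
  with assms(1) have "eqv brauer_pres ?m ?n s t"
    by (intro eqv_rels) simp_all
  then show ?thesis
    by (rule expr_class_eqI)
qed

lemma
  shows cross_cross: "bcls (HH \<cdot> HH) = bcls (Idn 2)"
    and snake_left: "bcls (rgt AA \<cdot> lft UU) = bcls (Idn 1)"
    and snake_right: "bcls (lft AA \<cdot> rgt UU) = bcls (Idn 1)"
    and cross_slide_cup: "bcls (rgt HH \<cdot> lft UU) = bcls (lft HH \<cdot> rgt UU)"
    and cross_cup: "bcls (HH \<cdot> UU) = bcls UU"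
  by (rule bcls_rel; simp add: brauer_rels_def)+

text \<open>The bending cup slides past \<open>HH\<close>; it then meets the cap on the second
  output of \<open>HH\<close>, and the two cancel by \<open>snake_left\<close>.\<close>

lemma bend_cap_cross_left: "bcls (rgt (lft AA \<cdot> rgt HH) \<cdot> (Idn 2 \<odot> UU)) = bcls HH"
proof -
  have "bcls (rgt (rgt HH) \<cdot> (Idn 2 \<odot> UU)) = bcls ((HH \<odot> Idn 2) \<cdot> (Idn 2 \<odot> UU))"
    by (rule cls_Comp_cong[OF cls_rgt_rgt refl])
  also have "\<dots> = bcls ((Idn 2 \<odot> UU) \<cdot> (HH \<odot> Idn 0))"
    by (rule cls_slide[symmetric]) auto
  also have "\<dots> = bcls (lft (lft UU) \<cdot> HH)"
    by (intro cls_Comp_cong cls_lft_lft[symmetric] expr_class_eqI[OF eqv_Tens_unit_right])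
      (simp add: typed_iff)
  finally have slide: "bcls (rgt (rgt HH) \<cdot> (Idn 2 \<odot> UU)) = bcls (lft (lft UU) \<cdot> HH)" .
  have "bcls (rgt (lft AA \<cdot> rgt HH) \<cdot> (Idn 2 \<odot> UU)) =
      bcls ((rgt (lft AA) \<cdot> rgt (rgt HH)) \<cdot> (Idn 2 \<odot> UU))"
    by (rule cls_Comp_cong[OF cls_rgt_Comp refl])
  also have "\<dots> = bcls (rgt (lft AA) \<cdot> rgt (rgt HH) \<cdot> (Idn 2 \<odot> UU))"
    by (rule cls_Comp_assoc)
  also have "\<dots> = bcls (lft (rgt AA) \<cdot> lft (lft UU) \<cdot> HH)"
    by (rule cls_Comp_cong[OF cls_Tens_assoc slide])
  also have "\<dots> = bcls ((lft (rgt AA) \<cdot> lft (lft UU)) \<cdot> HH)"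
    by (rule cls_Comp_assoc[symmetric])
  also have "\<dots> = bcls (lft (rgt AA \<cdot> lft UU) \<cdot> HH)"
    by (rule cls_Comp_cong[OF cls_lft_Comp[symmetric] refl])
  also have "\<dots> = bcls (lft (Idn 1) \<cdot> HH)"
    by (intro cls_Comp_cong cls_Tens_cong refl snake_left)
  also have "\<dots> = bcls (Idn 2 \<cdot> HH)"
    by (intro cls_Comp_cong refl) (simp add: cls_Tens_Idn numeral_2_eq_2)
  also have "\<dots> = bcls HH"
    by (simp add: cls_Idn_Comp)
  finally show ?thesis .
qed

text \<open>Here crossing and bending cup share a strand. \<open>cross_slide_cup\<close> moves the
  crossing to the last two of four strands, away from the cap on the first two. The cap can then
  slide past it and cancel the cup by \<open>snake_left\<close>.\<close>

lemma bend_cap_cross_right: "bcls (rgt (rgt AA \<cdot> lft HH) \<cdot> (Idn 2 \<odot> UU)) = bcls HH"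
proof -
  have "bcls (rgt (rgt AA) \<cdot> lft (lft HH)) = bcls ((AA \<odot> Idn 2) \<cdot> (Idn 2 \<odot> HH))"
    by (rule cls_Comp_cong[OF cls_rgt_rgt cls_lft_lft])
  also have "\<dots> = bcls ((Idn 0 \<odot> HH) \<cdot> (AA \<odot> Idn 2))"
    by (rule cls_slide[symmetric]) auto
  also have "\<dots> = bcls (HH \<cdot> rgt (rgt AA))"
    by (intro cls_Comp_cong cls_rgt_rgt[symmetric] expr_class_eqI[OF eqv_Tens_unit_left])
      (simp add: typed_iff)
  finally have slide: "bcls (rgt (rgt AA) \<cdot> lft (lft HH)) = bcls (HH \<cdot> rgt (rgt AA))" .
  have "bcls (rgt (lft HH) \<cdot> (Idn 2 \<odot> UU)) = bcls (lft (rgt HH) \<cdot> lft (lft UU))"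
    by (rule cls_Comp_cong[OF cls_Tens_assoc cls_lft_lft[symmetric]])
  also have "\<dots> = bcls (lft (rgt HH \<cdot> lft UU))"
    by (rule cls_lft_Comp[symmetric])
  also have "\<dots> = bcls (lft (lft HH \<cdot> rgt UU))"
    by (intro cls_Tens_cong refl cross_slide_cup)
  also have "\<dots> = bcls (lft (lft HH) \<cdot> lft (rgt UU))"
    by (rule cls_lft_Comp)
  finally have rotate: "bcls (rgt (lft HH) \<cdot> (Idn 2 \<odot> UU)) = bcls (lft (lft HH) \<cdot> lft (rgt UU))" .
  have "bcls (rgt (rgt AA \<cdot> lft HH) \<cdot> (Idn 2 \<odot> UU)) =
      bcls ((rgt (rgt AA) \<cdot> rgt (lft HH)) \<cdot> (Idn 2 \<odot> UU))"
    by (rule cls_Comp_cong[OF cls_rgt_Comp refl])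
  also have "\<dots> = bcls (rgt (rgt AA) \<cdot> rgt (lft HH) \<cdot> (Idn 2 \<odot> UU))"
    by (rule cls_Comp_assoc)
  also have "\<dots> = bcls (rgt (rgt AA) \<cdot> lft (lft HH) \<cdot> lft (rgt UU))"
    by (rule cls_Comp_cong[OF refl rotate])
  also have "\<dots> = bcls ((rgt (rgt AA) \<cdot> lft (lft HH)) \<cdot> lft (rgt UU))"
    by (rule cls_Comp_assoc[symmetric])
  also have "\<dots> = bcls ((HH \<cdot> rgt (rgt AA)) \<cdot> rgt (lft UU))"
    by (rule cls_Comp_cong[OF slide cls_Tens_assoc[symmetric]])
  also have "\<dots> = bcls (HH \<cdot> rgt (rgt AA) \<cdot> rgt (lft UU))"
    by (rule cls_Comp_assoc)
  also have "\<dots> = bcls (HH \<cdot> rgt (rgt AA \<cdot> lft UU))"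
    by (rule cls_Comp_cong[OF refl cls_rgt_Comp[symmetric]])
  also have "\<dots> = bcls (HH \<cdot> rgt (Idn 1))"
    by (intro cls_Comp_cong cls_Tens_cong refl snake_left)
  also have "\<dots> = bcls (HH \<cdot> Idn 2)"
    by (intro cls_Comp_cong refl) (simp add: cls_Tens_Idn numeral_2_eq_2)
  also have "\<dots> = bcls HH"
    by (simp add: cls_Comp_Idn)
  finally show ?thesis .
qed

lemma cap_slide_cross: "bcls (lft AA \<cdot> rgt HH) = bcls (rgt AA \<cdot> lft HH)"
  by (rule cls_bend_inject[where a = AA and u = UU and m = 2])
    \<comment> \<open>Leaving \<open>1\<close> unexpanded keeps the goals in the form of the facts
      about \<open>Idn 1\<close>.\<close>
    (simp_all add: bend_cap_cross_left bend_cap_cross_right snake_right del: One_nat_def)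

text \<open>\<open>cap_slide_cross\<close> moves the crossing onto the two legs of the cup, where
  \<open>cross_cup\<close> absorbs it; a snake remains.\<close>

lemma bcls_twist: "bcls (rgt AA \<cdot> lft HH \<cdot> rgt UU) = bcls (Idn 1)"
proof -
  have "bcls (rgt AA \<cdot> lft HH \<cdot> rgt UU) = bcls ((rgt AA \<cdot> lft HH) \<cdot> rgt UU)"
    by (rule cls_Comp_assoc[symmetric])
  also have "\<dots> = bcls ((lft AA \<cdot> rgt HH) \<cdot> rgt UU)"
    by (rule cls_Comp_cong[OF cap_slide_cross[symmetric] refl])
  also have "\<dots> = bcls (lft AA \<cdot> rgt HH \<cdot> rgt UU)"
    by (rule cls_Comp_assoc)
  also have "\<dots> = bcls (lft AA \<cdot> rgt (HH \<cdot> UU))"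
    by (rule cls_Comp_cong[OF refl cls_rgt_Comp[symmetric]])
  also have "\<dots> = bcls (lft AA \<cdot> rgt UU)"
    by (intro cls_Comp_cong cls_Tens_cong refl cross_cup)
  also have "\<dots> = bcls (Idn 1)"
    by (rule snake_right)
  finally show ?thesis .
qed

text \<open>Bending \<open>AA \<cdot> HH\<close> yields, after \<open>cross_slide_cup\<close>, the
  twist, hence the identity; \<open>AA\<close> bends to the identity by
  \<open>snake_left\<close>.\<close>

lemma cap_cross: "bcls (AA \<cdot> HH) = bcls AA"
proof (rule cls_bend_inject[where a = AA and u = UU and m = 1])
  have "bcls (rgt (AA \<cdot> HH) \<cdot> lft UU) = bcls ((rgt AA \<cdot> rgt HH) \<cdot> lft UU)"
    by (rule cls_Comp_cong[OF cls_rgt_Comp refl])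
  also have "\<dots> = bcls (rgt AA \<cdot> rgt HH \<cdot> lft UU)"
    by (rule cls_Comp_assoc)
  also have "\<dots> = bcls (rgt AA \<cdot> lft HH \<cdot> rgt UU)"
    by (rule cls_Comp_cong[OF refl cross_slide_cup])
  also have "\<dots> = bcls (Idn 1)"
    by (rule bcls_twist)
  finally show "bcls (rgt (AA \<cdot> HH) \<cdot> lft UU) = bcls (rgt AA \<cdot> lft UU)"
    by (simp only: snake_left)
qed (simp_all add: snake_right del: One_nat_def)

lemma rgt_cross_cross: "bcls (rgt HH \<cdot> rgt HH) = bcls (Idn 3)"
proof -
  have "bcls (rgt HH \<cdot> rgt HH) = bcls (rgt (HH \<cdot> HH))"
    by (rule cls_rgt_Comp[symmetric])
  also have "\<dots> = bcls (rgt (Idn 2))"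
    by (intro cls_Tens_cong refl cross_cross)
  also have "\<dots> = bcls (Idn 3)"
    by (simp add: cls_Tens_Idn)
  finally show ?thesis .
qed

text \<open>\<open>cross_slide_cup\<close> brings two crossings together on the first two strands,
  where they cancel.\<close>

lemma cup_rotate: "bcls (rgt HH \<cdot> lft HH \<cdot> rgt UU) = bcls (lft UU)"
proof -
  have "bcls (rgt HH \<cdot> lft HH \<cdot> rgt UU) = bcls (rgt HH \<cdot> rgt HH \<cdot> lft UU)"
    by (rule cls_Comp_cong[OF refl cross_slide_cup[symmetric]])
  also have "\<dots> = bcls ((rgt HH \<cdot> rgt HH) \<cdot> lft UU)"
    by (rule cls_Comp_assoc[symmetric])
  also have "\<dots> = bcls (Idn 3 \<cdot> lft UU)"
    by (rule cls_Comp_cong[OF rgt_cross_cross refl])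
  also have "\<dots> = bcls (lft UU)"
    by (simp add: cls_Idn_Comp)
  finally show ?thesis .
qed

text \<open>The same cancellation on the cap side, with \<open>cap_slide_cross\<close> in place of
  \<open>cross_slide_cup\<close>.\<close>

lemma cap_rotate: "bcls (rgt AA \<cdot> lft HH \<cdot> rgt HH) = bcls (lft AA)"
proof -
  have "bcls (rgt AA \<cdot> lft HH \<cdot> rgt HH) = bcls ((rgt AA \<cdot> lft HH) \<cdot> rgt HH)"
    by (rule cls_Comp_assoc[symmetric])
  also have "\<dots> = bcls ((lft AA \<cdot> rgt HH) \<cdot> rgt HH)"
    by (rule cls_Comp_cong[OF cap_slide_cross[symmetric] refl])
  also have "\<dots> = bcls (lft AA \<cdot> rgt HH \<cdot> rgt HH)"
    by (rule cls_Comp_assoc)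
  also have "\<dots> = bcls (lft AA \<cdot> Idn 3)"
    by (rule cls_Comp_cong[OF refl rgt_cross_cross])
  also have "\<dots> = bcls (lft AA)"
    by (simp add: cls_Comp_Idn)
  finally show ?thesis .
qed

section \<open>Equality of the two categories\<close>

lemma brauer_type_rels_hold: "(s, t) \<in> brauer_type_rels \<delta> \<Longrightarrow> bcls s = bcls t"
  unfolding brauer_type_rels_def
  \<comment> \<open>The five named lemmas are the relations absent from \<open>brauer_rels\<close>;
    the other seven occur there, one of them with its sides exchanged.\<close>
  by (elim insertE emptyE Pair_inject; hypsubst;
    (rule cap_cross bcls_twist cap_slide_cross cup_rotate cap_rotate |
     rule bcls_rel; simp add: brauer_rels_def))

lemma brauer_type_cat_eq_brauer_cat: "brauer_type_cat \<delta> = brauer_cat \<delta>"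
  unfolding brauer_type_cat_def brauer_cat_def
proof (rule presented_cat_eqI)
  fix s t and m n :: nat
  assume "(s, t) \<in> rels \<lparr>src = gen_src, tgt = gen_tgt, rels = brauer_type_rels \<delta>\<rparr>"
    and typed: "typed brauer_pres m n s"
  then have "bcls s = bcls t"
    using brauer_type_rels_hold by simp
  with typed show "eqv brauer_pres m n s t"
    by (simp add: expr_class_eq_iff)
next
  fix s t and m n :: nat
  let ?Q = "\<lparr>src = gen_src, tgt = gen_tgt, rels = brauer_type_rels \<delta>\<rparr>"
  assume "(s, t) \<in> rels brauer_pres" and typed: "typed ?Q m n s" "typed ?Q m n t"
  then have "(s, t) \<in> brauer_rels \<delta>"
    by simp
  then have "(s, t) \<in> brauer_type_rels \<delta> \<or> (t, s) \<in> brauer_type_rels \<delta>"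
    unfolding brauer_rels_def
    by (elim insertE emptyE Pair_inject; hypsubst; simp add: brauer_type_rels_def)
  then show "eqv ?Q m n s t"
    using typed by (intro eqv_rels) simp_all
qed simp_all

end

theorem corollary10p4:
  fixes \<delta> :: "'k::field"
  assumes "CHAR('k) \<noteq> 2"
  shows "strict_monoidal_isomorphic (brauer_type_cat \<delta>) (brauer_cat \<delta>)"
  \<comment> \<open>Both categories are the same record, so identity functors witness the
    isomorphism.\<close>
  unfolding brauer_type_cat_eq_brauer_cat
  unfolding brauer_cat_def
  by (intro strict_monoidal_isomorphic_refl strict_monoidal_lin_category_presented_cat)

end
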